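(* Let $\Omega\subset\mathbf R^n$ ($n=1,2$) be a bounded open domain, and let $0<\rho_1\le\rho_2\le\cdots$ be the positive eigenvalues of $-\Delta$ on $\Omega$ with Neumann boundary conditions (as ordered in the context). Let $B=\begin{pmatrix} f_u & f_v\\ g_u & g_v\end{pmatrix}$ be a real matrix with $f_u>0$, $g_v<0$, $f_ug_v-f_vg_u>0$ and $f_u+g_v<0$, and let $D=\mathrm{diag}(1,d)$. For $\lambda=(\gamma,d)$ with $\gamma,d>0$ and $k=1,2,\ldots$, put $E_k(\lambda)=-\rho_kD+\gamma B$ and let $$\beta_{k1,2}(\lambda)=\tfrac12\Big(\mathrm{tr}\,E_k(\lambda)\pm\big((\mathrm{tr}\,E_k(\lambda))^2-4\det E_k(\lambda)\big)^{1/2}\Big)$$ (upper sign for $\beta_{k1}$, lower sign for $\beta_{k2}$). Let $\Lambda_1$, $R_1$, $R_2$ be as defined in the context. Then $$\Re\beta_{11}(\lambda)<0,\ \Re\beta_{12}(\lambda)<0 \text{ if } \lambda\in R_1;\qquad \beta_{11}(\lambda)=0,\ \beta_{12}(\lambda)<0 \text{ if } \lambda\in\Lambda_1;\qquad \beta_{11}(\lambda)>0,\ \beta_{12}(\lambda)<0 \text{ if } \lambda\in R_2.$$ Furthermore, for $k=2,3,\ldots$, $\Re\beta_{k1}(\lambda)<0$ and $\Re\beta_{k2}(\lambda)<0$ if $\lambda\in\Lambda_1$.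
   Context: The numbers $\beta_{k1},\beta_{k2}$ are the eigenvalues of the linearized operator $L_\lambda=\Delta D+\gamma B$ (acting on pairs of functions with Neumann boundary conditions) restricted to the span of the $k$-th Laplace eigenfunction. For $k=1,2$ define, for $\gamma>\rho_k/f_u$, $$d_k(\gamma)=\frac{\gamma^2\det(B)+\gamma\rho_k|g_v|}{\rho_k(\gamma f_u-\rho_k)},$$ so that $\det E_k(\lambda)=0$ exactly when $d=d_k(\gamma)$; the set $\{(\gamma,d):d=d_k(\gamma),\ \gamma>\rho_k/f_u\}$ is the positive branch of the curve $\Lambda_k$. Let $\gamma_1$ be the value of $\gamma$ at which the positive branches of $\Lambda_1$ and $\Lambda_2$ cross. Then $\Lambda_1$ here denotes $\{(\gamma,d_1(\gamma)):\rho_1/f_u<\gamma<\gamma_1\}$, and $R_1=\{(\gamma,d):\rho_1/f_u<\gamma<\gamma_1,\ 0<d<d_1(\gamma)\}$, $R_2=\{(\gamma,d):\rho_1/f_u<\gamma<\gamma_1,\ d_1(\gamma)<d<d_2(\gamma)\}$. *)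

theory Defs
  imports "HOL-Analysis.Analysis"
begin

definition Bmat :: "real \<Rightarrow> real \<Rightarrow> real \<Rightarrow> real \<Rightarrow> real^2^2" where
  "Bmat fu fv gu gv = (\<chi> i j. if i = 1 then (if j = 1 then fu else fv)
                                  else (if j = 1 then gu else gv))"

definition Dmat :: "real \<Rightarrow> real^2^2" where
  "Dmat d = (\<chi> i j. if i = j then (if i = 1 then 1 else d) else 0)"

definition Emat :: "real^2^2 \<Rightarrow> real \<Rightarrow> real \<Rightarrow> real \<Rightarrow> real^2^2" where
  "Emat B rk \<gamma> d = (- rk) *\<^sub>R Dmat d + \<gamma> *\<^sub>R B"

definition beta1 :: "real^2^2 \<Rightarrow> complex" where
  "beta1 E = (complex_of_real (trace E)
              + csqrt (complex_of_real ((trace E)\<^sup>2 - 4 * det E))) / 2"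

definition beta2 :: "real^2^2 \<Rightarrow> complex" where
  "beta2 E = (complex_of_real (trace E)
              - csqrt (complex_of_real ((trace E)\<^sup>2 - 4 * det E))) / 2"

definition dcurve :: "real^2^2 \<Rightarrow> real \<Rightarrow> real \<Rightarrow> real \<Rightarrow> real" where
  "dcurve B gv rk \<gamma> = (\<gamma>\<^sup>2 * det B + \<gamma> * rk * \<bar>gv\<bar>) / (rk * (\<gamma> * B $ 1 $ 1 - rk))"

end

theory Submission
  imports Defs
begin

text \<open>
  Since \<open>tr E\<^sub>k(\<lambda>) < 0\<close> whenever \<open>\<gamma>, d > 0\<close>, the signs of the eigenvalues are decided by
  \<open>det E\<^sub>k(\<lambda>) = \<rho>\<^sub>k (\<gamma> f\<^sub>u - \<rho>\<^sub>k) (d\<^sub>k(\<gamma>) - d)\<close>. This settles the mode \<open>k = 1\<close> at once. For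
  the higher modes on \<open>\<Lambda>\<^sub>1\<close>, \<open>det E\<^sub>k\<close> is a convex quadratic in \<open>\<rho>\<^sub>k\<close> vanishing at \<open>\<rho>\<^sub>1\<close>;
  it therefore suffices that it is positive at \<open>\<rho>\<^sub>2\<close>, i.e. that \<open>\<Lambda>\<^sub>1\<close> lies below \<open>\<Lambda>\<^sub>2\<close> left
  of their crossing \<open>\<gamma>\<^sub>1\<close>. Cross-multiplied, \<open>d\<^sub>2 - d\<^sub>1\<close> has the sign of minus a convex
  quadratic in \<open>\<gamma>\<close> that is negative at \<open>\<rho>\<^sub>2/f\<^sub>u\<close> and vanishes at \<open>\<gamma>\<^sub>1\<close>, hence is negative
  in between.
\<close>

lemma quadratic_strict_increasing_after:
  fixes a b c x y z :: real
  assumes "a \<ge> 0" "x < y" "y < z"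
    and "a * x\<^sup>2 + b * x + c < a * y\<^sup>2 + b * y + c"
  shows "a * y\<^sup>2 + b * y + c < a * z\<^sup>2 + b * z + c"
proof -
  have "0 < (a * y\<^sup>2 + b * y + c) - (a * x\<^sup>2 + b * x + c)"
    using assms(4) by simp
  also have "\<dots> = (y - x) * (a * (x + y) + b)"
    by (simp add: algebra_simps power2_eq_square)
  finally have "a * (x + y) + b > 0"
    using \<open>x < y\<close> by (simp add: zero_less_mult_iff)
  moreover have "a * (x + y) \<le> a * (y + z)"
    using assms(1-3) by (simp add: mult_left_mono)
  ultimately have "0 < (z - y) * (a * (y + z) + b)"
    using \<open>y < z\<close> by simp
  also have "\<dots> = (a * z\<^sup>2 + b * z + c) - (a * y\<^sup>2 + b * y + c)"
    by (simp add: algebra_simps power2_eq_square)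
  finally show ?thesis by simp
qed

lemma beta_of_real_discriminant:
  fixes E :: "real^2^2"
  assumes "(trace E)\<^sup>2 - 4 * det E \<ge> 0"
  shows "beta1 E = of_real ((trace E + sqrt ((trace E)\<^sup>2 - 4 * det E)) / 2)"
    and "beta2 E = of_real ((trace E - sqrt ((trace E)\<^sup>2 - 4 * det E)) / 2)"
  using csqrt_of_real[OF assms] unfolding beta1_def beta2_def by simp_all

lemma Re_beta_neg_of_det_pos:
  fixes E :: "real^2^2"
  assumes "trace E < 0" "det E > 0"
  shows "Re (beta1 E) < 0 \<and> Re (beta2 E) < 0"
proof (cases "(trace E)\<^sup>2 - 4 * det E \<ge> 0")
  case True
  have "(trace E)\<^sup>2 - 4 * det E < (- trace E)\<^sup>2"
    using assms by simp
  then have "sqrt ((trace E)\<^sup>2 - 4 * det E) < - trace E"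
    using assms by (simp add: real_sqrt_less_iff real_less_lsqrt True)
  then show ?thesis
    using assms real_sqrt_ge_zero[OF True] unfolding beta_of_real_discriminant[OF True]
    by (simp del: real_sqrt_ge_zero; linarith)
next
  case False
  then have "Re (csqrt (complex_of_real ((trace E)\<^sup>2 - 4 * det E))) = 0"
    by (simp del: of_real_diff of_real_power of_real_mult)
  then show ?thesis
    using assms unfolding beta1_def beta2_def by simp
qed

lemma beta_of_det_zero:
  fixes E :: "real^2^2"
  assumes "trace E < 0" "det E = 0"
  shows "beta1 E = 0 \<and> beta2 E \<in> \<real> \<and> Re (beta2 E) < 0"
  using assms beta_of_real_discriminant[of E] by simp

lemma beta_of_det_neg:
  fixes E :: "real^2^2"
  assumes "trace E < 0" "det E < 0"
  shows "beta1 E \<in> \<real> \<and> Re (beta1 E) > 0 \<and> beta2 E \<in> \<real> \<and> Re (beta2 E) < 0"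
proof -
  have discr: "(trace E)\<^sup>2 < (trace E)\<^sup>2 - 4 * det E"
    using assms by simp
  then have "sqrt ((trace E)\<^sup>2) < sqrt ((trace E)\<^sup>2 - 4 * det E)"
    by (simp only: real_sqrt_less_iff)
  then have "\<bar>trace E\<bar> < sqrt ((trace E)\<^sup>2 - 4 * det E)"
    by simp
  moreover have "(trace E)\<^sup>2 - 4 * det E \<ge> 0"
    using discr zero_le_power2[of "trace E"] by linarith
  ultimately show ?thesis
    using assms unfolding beta_of_real_discriminant[OF \<open>_ \<ge> 0\<close>] by simp
qed

lemma trace_Emat: "trace (Emat (Bmat fu fv gu gv) r \<gamma> d) = - r * (1 + d) + \<gamma> * (fu + gv)"
  by (simp add: Emat_def Bmat_def Dmat_def trace_def UNIV_2 algebra_simps)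

lemma det_Emat:
  "det (Emat (Bmat fu fv gu gv) r \<gamma> d)
     = d * r\<^sup>2 + (- \<gamma> * (fu * d + gv)) * r + \<gamma>\<^sup>2 * (fu * gv - fv * gu)"
  by (simp add: Emat_def Bmat_def Dmat_def det_2 algebra_simps power2_eq_square)

lemma dcurve_Bmat:
  "dcurve (Bmat fu fv gu gv) gv r \<gamma>
     = (\<gamma>\<^sup>2 * (fu * gv - fv * gu) + \<gamma> * r * \<bar>gv\<bar>) / (r * (\<gamma> * fu - r))"
  by (simp add: dcurve_def Bmat_def det_2)

lemma trace_Emat_neg:
  assumes "fu + gv < 0" "r > 0" "d > 0" "\<gamma> \<ge> 0"
  shows "trace (Emat (Bmat fu fv gu gv) r \<gamma> d) < 0"
proof -
  have "r * (1 + d) > 0" "\<gamma> * (fu + gv) \<le> 0"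
    using assms by (simp_all add: mult_nonneg_nonpos)
  then show ?thesis
    unfolding trace_Emat by linarith
qed

lemma dcurve_mult_denominator:
  assumes "gv < 0" "r * (\<gamma> * fu - r) \<noteq> 0"
  shows "r * (\<gamma> * fu - r) * dcurve (Bmat fu fv gu gv) gv r \<gamma>
           = \<gamma>\<^sup>2 * (fu * gv - fv * gu) - \<gamma> * r * gv"
  using assms unfolding dcurve_Bmat by simp

lemma det_Emat_eq_dcurve:
  assumes "gv < 0" "r * (\<gamma> * fu - r) \<noteq> 0"
  shows "det (Emat (Bmat fu fv gu gv) r \<gamma> d)
           = r * (\<gamma> * fu - r) * (dcurve (Bmat fu fv gu gv) gv r \<gamma> - d)"
proof -
  have "r * (\<gamma> * fu - r) * (dcurve (Bmat fu fv gu gv) gv r \<gamma> - d)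
      = r * (\<gamma> * fu - r) * dcurve (Bmat fu fv gu gv) gv r \<gamma> - r * (\<gamma> * fu - r) * d"
    by (simp add: right_diff_distrib)
  also have "\<dots> = \<gamma>\<^sup>2 * (fu * gv - fv * gu) - \<gamma> * r * gv - r * (\<gamma> * fu - r) * d"
    by (simp only: dcurve_mult_denominator[OF assms])
  finally show ?thesis
    unfolding det_Emat by (simp add: algebra_simps power2_eq_square)
qed

lemma above_threshold:
  fixes fu r \<gamma> :: real
  assumes "fu > 0" "r > 0" "r / fu < \<gamma>"
  shows "\<gamma> > 0" "r < \<gamma> * fu"
  using assms divide_pos_pos[of r fu] by (linarith, simp add: field_simps)

lemma dcurve_pos:
  assumes "fu > 0" "fu * gv - fv * gu > 0" "r > 0" "r / fu < \<gamma>"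
  shows "dcurve (Bmat fu fv gu gv) gv r \<gamma> > 0"
proof -
  have "\<gamma> > 0" "\<gamma> * fu > r"
    using above_threshold[of fu r \<gamma>] assms by simp_all
  then show ?thesis
    unfolding dcurve_Bmat using assms
    by (intro divide_pos_pos add_pos_nonneg) simp_all
qed

lemma dcurve_less_before_crossing:
  fixes fu fv gu gv r1 r2 \<gamma> \<gamma>c :: real
  defines "B \<equiv> Bmat fu fv gu gv"
  assumes "fu > 0" "gv < 0" "fu * gv - fv * gu > 0" "0 < r1" "r1 < r2"
    and "r2 / fu < \<gamma>" "\<gamma> < \<gamma>c"
    and crossing: "dcurve B gv r1 \<gamma>c = dcurve B gv r2 \<gamma>c"
  shows "dcurve B gv r1 \<gamma> < dcurve B gv r2 \<gamma>"
proof -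
  define a where "a = fu * gv - fv * gu"
  define p where "p x = (fu * a) * x\<^sup>2 + (- a * (r1 + r2)) * x + (- \<bar>gv\<bar> * r1 * r2)" for x
  have cross_mult: "r1 * (x * fu - r1) * (r2 * (x * fu - r2)) * (dcurve B gv r2 x - dcurve B gv r1 x)
      = (r1 - r2) * x * p x" if "x * fu > r2" for x
  proof -
    have "r1 * (x * fu - r1) \<noteq> 0" "r2 * (x * fu - r2) \<noteq> 0"
      using that assms by auto
    note n = dcurve_mult_denominator[OF \<open>gv < 0\<close>, of _ x fu fv gu, folded B_def a_def]
    have "r1 * (x * fu - r1) * (r2 * (x * fu - r2)) * (dcurve B gv r2 x - dcurve B gv r1 x)
        = r1 * (x * fu - r1) * (r2 * (x * fu - r2) * dcurve B gv r2 x)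
          - r2 * (x * fu - r2) * (r1 * (x * fu - r1) * dcurve B gv r1 x)"
      by (simp add: algebra_simps)
    also have "\<dots> = r1 * (x * fu - r1) * (x\<^sup>2 * a - x * r2 * gv)
                   - r2 * (x * fu - r2) * (x\<^sup>2 * a - x * r1 * gv)"
      using n \<open>r1 * (x * fu - r1) \<noteq> 0\<close> \<open>r2 * (x * fu - r2) \<noteq> 0\<close> by simp
    also have "\<dots> = (r1 - r2) * x * p x"
      using \<open>gv < 0\<close> unfolding p_def by (simp add: algebra_simps power2_eq_square)
    finally show ?thesis .
  qed
  have above: "x * fu > r2" if "r2 / fu < x" for x
    using that \<open>fu > 0\<close> by (simp add: field_simps)
  have "r2 / fu > 0" "r2 / fu < \<gamma>c"
    using assms by simp_all
  have "(r1 - r2) * \<gamma>c * p \<gamma>c = 0"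
    using cross_mult[OF above[OF \<open>r2 / fu < \<gamma>c\<close>]] crossing by simp
  then have "p \<gamma>c = 0"
    using \<open>r1 < r2\<close> \<open>r2 / fu > 0\<close> \<open>r2 / fu < \<gamma>c\<close> by simp
  have "p (r2 / fu) = - a * r1 * (r2 / fu) - \<bar>gv\<bar> * r1 * r2"
    using \<open>fu > 0\<close> unfolding p_def by (simp add: field_simps power2_eq_square)
  also have "\<dots> < 0"
  proof -
    have "a * r1 * (r2 / fu) > 0" "\<bar>gv\<bar> * r1 * r2 > 0"
      using assms \<open>r2 / fu > 0\<close> unfolding a_def by (intro mult_pos_pos; simp)+
    then show ?thesis by linarith
  qed
  finally have "p (r2 / fu) < 0" .
  have "fu * a \<ge> 0"
    using assms unfolding a_def by simp
  have "p \<gamma> < 0"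
  proof (rule ccontr)
    assume "\<not> p \<gamma> < 0"
    then have "p (r2 / fu) < p \<gamma>"
      using \<open>p (r2 / fu) < 0\<close> by simp
    then have "p \<gamma> < p \<gamma>c"
      using quadratic_strict_increasing_after[OF \<open>fu * a \<ge> 0\<close> \<open>r2 / fu < \<gamma>\<close> \<open>\<gamma> < \<gamma>c\<close>]
      unfolding p_def by blast
    with \<open>\<not> p \<gamma> < 0\<close> \<open>p \<gamma>c = 0\<close> show False by simp
  qed
  moreover have "(r1 - r2) * \<gamma> < 0"
    using \<open>r1 < r2\<close> \<open>r2 / fu > 0\<close> \<open>r2 / fu < \<gamma>\<close> by (intro mult_neg_pos) simp_all
  ultimately have
    "r1 * (\<gamma> * fu - r1) * (r2 * (\<gamma> * fu - r2)) * (dcurve B gv r2 \<gamma> - dcurve B gv r1 \<gamma>) > 0"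
    using cross_mult[OF above[OF \<open>r2 / fu < \<gamma>\<close>]] by (simp add: mult_neg_neg)
  moreover have "r1 * (\<gamma> * fu - r1) * (r2 * (\<gamma> * fu - r2)) > 0"
    using above[OF \<open>r2 / fu < \<gamma>\<close>] assms by simp
  ultimately show ?thesis
    by (simp add: zero_less_mult_iff)
qed

lemma det_Emat_higher_mode_pos_on_dcurve:
  fixes fu fv gu gv r1 r2 r \<gamma> \<gamma>c :: real
  defines "B \<equiv> Bmat fu fv gu gv"
  assumes "fu > 0" "gv < 0" "fu * gv - fv * gu > 0" "0 < r1" "r1 < r2" "r2 \<le> r"
    and "r1 / fu < \<gamma>" "\<gamma> < \<gamma>c" "dcurve B gv r1 \<gamma>c = dcurve B gv r2 \<gamma>c"
  shows "det (Emat B r \<gamma> (dcurve B gv r1 \<gamma>)) > 0"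
proof -
  define d1 where "d1 = dcurve B gv r1 \<gamma>"
  have "\<gamma> > 0" "\<gamma> * fu > r1"
    using above_threshold[of fu r1 \<gamma>] assms by simp_all
  have "d1 > 0"
    using dcurve_pos[of fu gv fv gu r1 \<gamma>] assms unfolding d1_def B_def by simp
  have det_at_r1: "det (Emat B r1 \<gamma> d1) = 0"
    using det_Emat_eq_dcurve[of gv r1 \<gamma> fu fv gu d1] assms \<open>\<gamma> * fu > r1\<close>
    unfolding d1_def B_def by simp
  have det_at_r2: "det (Emat B r2 \<gamma> d1) > 0"
  proof (cases "\<gamma> * fu \<le> r2")
    case True
    have "det (Emat B r2 \<gamma> d1)
        = d1 * r2 * (r2 - \<gamma> * fu) + \<gamma> * r2 * (- gv) + \<gamma>\<^sup>2 * (fu * gv - fv * gu)"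
      unfolding B_def det_Emat by (simp add: algebra_simps power2_eq_square)
    moreover have "d1 * r2 * (r2 - \<gamma> * fu) \<ge> 0" "\<gamma> * r2 * (- gv) > 0"
      "\<gamma>\<^sup>2 * (fu * gv - fv * gu) > 0"
      using True assms \<open>\<gamma> > 0\<close> \<open>d1 > 0\<close> by (simp_all add: mult_pos_neg)
    ultimately show ?thesis by linarith
  next
    case False
    then have "d1 < dcurve B gv r2 \<gamma>"
      using dcurve_less_before_crossing[of fu gv fv gu r1 r2 \<gamma> \<gamma>c] assms
      unfolding d1_def by (simp add: field_simps)
    moreover have "det (Emat B r2 \<gamma> d1) = r2 * (\<gamma> * fu - r2) * (dcurve B gv r2 \<gamma> - d1)"
      using det_Emat_eq_dcurve[of gv r2 \<gamma> fu fv gu d1] assms False unfolding B_def by simp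
    ultimately show ?thesis
      using False assms by simp
  qed
  show ?thesis
  proof (cases "r = r2")
    case False
    have "det (Emat B r2 \<gamma> d1) < det (Emat B r \<gamma> d1)"
      unfolding B_def det_Emat
    proof (rule quadratic_strict_increasing_after[where x = r1])
      show "d1 * r1\<^sup>2 + - \<gamma> * (fu * d1 + gv) * r1 + \<gamma>\<^sup>2 * (fu * gv - fv * gu)
          < d1 * r2\<^sup>2 + - \<gamma> * (fu * d1 + gv) * r2 + \<gamma>\<^sup>2 * (fu * gv - fv * gu)"
        using det_at_r1 det_at_r2 unfolding B_def det_Emat by simp
    qed (use \<open>d1 > 0\<close> \<open>r1 < r2\<close> \<open>r2 \<le> r\<close> False in simp_all)
    then show ?thesis
      using det_at_r2 unfolding d1_def by simp
  qed (use det_at_r2 d1_def in simp)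
qed

lemma Emat_eigenvalues_below_dcurve:
  fixes fu fv gu gv r \<gamma> d :: real
  defines "B \<equiv> Bmat fu fv gu gv"
  assumes "fu > 0" "gv < 0" "fu + gv < 0" "r > 0" "r / fu < \<gamma>"
    and "0 < d" "d < dcurve B gv r \<gamma>"
  shows "Re (beta1 (Emat B r \<gamma> d)) < 0 \<and> Re (beta2 (Emat B r \<gamma> d)) < 0"
proof (rule Re_beta_neg_of_det_pos)
  have "\<gamma> > 0" "\<gamma> * fu > r"
    using above_threshold[of fu r \<gamma>] assms by simp_all
  then show "det (Emat B r \<gamma> d) > 0" "trace (Emat B r \<gamma> d) < 0"
    using det_Emat_eq_dcurve[of gv r \<gamma> fu fv gu d] trace_Emat_neg[of fu gv r d \<gamma> fv gu] assms
    unfolding B_def by simp_all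
qed

lemma Emat_eigenvalues_on_dcurve:
  fixes fu fv gu gv r \<gamma> :: real
  defines "B \<equiv> Bmat fu fv gu gv"
  assumes "fu > 0" "gv < 0" "fu * gv - fv * gu > 0" "fu + gv < 0" "r > 0" "r / fu < \<gamma>"
  shows "beta1 (Emat B r \<gamma> (dcurve B gv r \<gamma>)) = 0
    \<and> beta2 (Emat B r \<gamma> (dcurve B gv r \<gamma>)) \<in> \<real>
    \<and> Re (beta2 (Emat B r \<gamma> (dcurve B gv r \<gamma>))) < 0"
proof (rule beta_of_det_zero)
  have "\<gamma> > 0" "\<gamma> * fu > r" "dcurve B gv r \<gamma> > 0"
    using above_threshold[of fu r \<gamma>] dcurve_pos[of fu gv fv gu r \<gamma>] assms
    unfolding B_def by simp_all
  then show "det (Emat B r \<gamma> (dcurve B gv r \<gamma>)) = 0"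
    and "trace (Emat B r \<gamma> (dcurve B gv r \<gamma>)) < 0"
    using det_Emat_eq_dcurve[of gv r \<gamma> fu fv gu] trace_Emat_neg[of fu gv r _ \<gamma> fv gu] assms
    unfolding B_def by simp_all
qed

lemma Emat_eigenvalues_above_dcurve:
  fixes fu fv gu gv r \<gamma> d :: real
  defines "B \<equiv> Bmat fu fv gu gv"
  assumes "fu > 0" "gv < 0" "fu * gv - fv * gu > 0" "fu + gv < 0" "r > 0" "r / fu < \<gamma>"
    and "dcurve B gv r \<gamma> < d"
  shows "beta1 (Emat B r \<gamma> d) \<in> \<real> \<and> Re (beta1 (Emat B r \<gamma> d)) > 0
    \<and> beta2 (Emat B r \<gamma> d) \<in> \<real> \<and> Re (beta2 (Emat B r \<gamma> d)) < 0"
proof (rule beta_of_det_neg)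
  have "\<gamma> > 0" "\<gamma> * fu > r" "d > 0"
    using above_threshold[of fu r \<gamma>] dcurve_pos[of fu gv fv gu r \<gamma>] assms
    unfolding B_def by simp_all
  then show "det (Emat B r \<gamma> d) < 0" "trace (Emat B r \<gamma> d) < 0"
    using det_Emat_eq_dcurve[of gv r \<gamma> fu fv gu d] trace_Emat_neg[of fu gv r d \<gamma> fv gu] assms
    unfolding B_def by (simp_all add: mult_pos_neg)
qed

lemma Emat_eigenvalues_higher_mode_on_dcurve:
  fixes fu fv gu gv r1 r2 r \<gamma> \<gamma>c :: real
  defines "B \<equiv> Bmat fu fv gu gv"
  assumes "fu > 0" "gv < 0" "fu * gv - fv * gu > 0" "fu + gv < 0"
    and "0 < r1" "r1 < r2" "r2 \<le> r"
    and "r1 / fu < \<gamma>" "\<gamma> < \<gamma>c" "dcurve B gv r1 \<gamma>c = dcurve B gv r2 \<gamma>c"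
  shows "Re (beta1 (Emat B r \<gamma> (dcurve B gv r1 \<gamma>))) < 0
    \<and> Re (beta2 (Emat B r \<gamma> (dcurve B gv r1 \<gamma>))) < 0"
proof (rule Re_beta_neg_of_det_pos)
  show "det (Emat B r \<gamma> (dcurve B gv r1 \<gamma>)) > 0"
    using det_Emat_higher_mode_pos_on_dcurve[of fu gv fv gu r1 r2 r \<gamma> \<gamma>c] assms
    unfolding B_def by simp
  have "\<gamma> > 0" "dcurve B gv r1 \<gamma> > 0"
    using above_threshold[of fu r1 \<gamma>] dcurve_pos[of fu gv fv gu r1 \<gamma>] assms
    unfolding B_def by simp_all
  then show "trace (Emat B r \<gamma> (dcurve B gv r1 \<gamma>)) < 0"
    using trace_Emat_neg[of fu gv r _ \<gamma> fv gu] assms unfolding B_def by simp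
qed

theorem lemma3p1:
  fixes \<rho> :: "nat \<Rightarrow> real" and fu fv gu gv \<gamma>1 :: real
  defines "B \<equiv> Bmat fu fv gu gv"
  assumes rho_pos: "0 < \<rho> 1"
    and rho_mono: "\<forall>k\<ge>1. \<rho> k \<le> \<rho> (Suc k)"
    and fu_pos: "fu > 0" and gv_neg: "gv < 0"
    and detB: "fu * gv - fv * gu > 0" and trB: "fu + gv < 0"
    and cross: "\<gamma>1 > \<rho> 2 / fu" "dcurve B gv (\<rho> 1) \<gamma>1 = dcurve B gv (\<rho> 2) \<gamma>1"
    and cross_unique: "\<forall>\<gamma>. \<gamma> > \<rho> 2 / fu \<and> dcurve B gv (\<rho> 1) \<gamma> = dcurve B gv (\<rho> 2) \<gamma>
                         \<longrightarrow> \<gamma> = \<gamma>1"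
  shows "\<forall>\<gamma> d. \<rho> 1 / fu < \<gamma> \<and> \<gamma> < \<gamma>1 \<longrightarrow>
     ((0 < d \<and> d < dcurve B gv (\<rho> 1) \<gamma> \<longrightarrow>
         Re (beta1 (Emat B (\<rho> 1) \<gamma> d)) < 0 \<and> Re (beta2 (Emat B (\<rho> 1) \<gamma> d)) < 0)
    \<and> (d = dcurve B gv (\<rho> 1) \<gamma> \<longrightarrow>
         beta1 (Emat B (\<rho> 1) \<gamma> d) = 0
         \<and> beta2 (Emat B (\<rho> 1) \<gamma> d) \<in> \<real> \<and> Re (beta2 (Emat B (\<rho> 1) \<gamma> d)) < 0)
    \<and> (dcurve B gv (\<rho> 1) \<gamma> < d \<and> d < dcurve B gv (\<rho> 2) \<gamma> \<longrightarrow>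
         beta1 (Emat B (\<rho> 1) \<gamma> d) \<in> \<real> \<and> Re (beta1 (Emat B (\<rho> 1) \<gamma> d)) > 0
         \<and> beta2 (Emat B (\<rho> 1) \<gamma> d) \<in> \<real> \<and> Re (beta2 (Emat B (\<rho> 1) \<gamma> d)) < 0)
    \<and> (d = dcurve B gv (\<rho> 1) \<gamma> \<longrightarrow>
         (\<forall>k\<ge>2. Re (beta1 (Emat B (\<rho> k) \<gamma> d)) < 0 \<and> Re (beta2 (Emat B (\<rho> k) \<gamma> d)) < 0)))"
proof -
  have \<rho>_ge_\<rho>2: "\<rho> 2 \<le> \<rho> k" if "k \<ge> 2" for k
    using that
  proof (induction k rule: dec_induct)
    case (step n)
    then show ?case using rho_mono[rule_format, of n] by simp
  qed simp
  \<comment> \<open>\<open>\<rho>\<^sub>1 < \<rho>\<^sub>2\<close> is not assumed: for \<open>\<rho>\<^sub>1 = \<rho>\<^sub>2\<close> the two curves would coincide,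
    contradicting the uniqueness of the crossing.\<close>
  have \<rho>12: "\<rho> 1 < \<rho> 2"
  proof (rule ccontr)
    assume "\<not> \<rho> 1 < \<rho> 2"
    then have "\<rho> 1 = \<rho> 2"
      using rho_mono[rule_format, of 1] by (simp add: numeral_2_eq_2)
    then show False
      using cross_unique[rule_format, of "\<gamma>1 + 1"] cross(1) by simp
  qed
  note below = Emat_eigenvalues_below_dcurve[OF fu_pos gv_neg trB rho_pos,
      where fv = fv and gu = gu, folded B_def]
  note on = Emat_eigenvalues_on_dcurve[OF fu_pos gv_neg detB trB rho_pos, folded B_def]
  note above = Emat_eigenvalues_above_dcurve[OF fu_pos gv_neg detB trB rho_pos, folded B_def]
  note higher = Emat_eigenvalues_higher_mode_on_dcurve[OF fu_pos gv_neg detB trB rho_pos \<rho>12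
      _ _ _ cross(2)[unfolded B_def], folded B_def]
  show ?thesis
    using below on above higher[OF \<rho>_ge_\<rho>2] by simp
qed

end
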